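(* Let $k\ge 2$, let $M$ be a matroid on a finite set $V$ and let $N$ be a matroid on $\mathrm{Sym}_k(V)$. Then the following two statements are equivalent (all properties of $N$ being with respect to $M$): (1) $N$ satisfies the Strong SP-rank Property and Weak Order Multilinearity. (2) $N$ satisfies the SP-rank Property, the Closure Property, and Weak Order Multilinearity. In addition, if $N$ satisfies the Strong SP-rank Property and Weak Order Multilinearity, then $N$ satisfies the Flat Property.
   Context: For a finite set $V$ and an integer $k\ge 0$, $\mathrm{Sym}_k(V)$ is the set of unordered $k$-words (multisets of size $k$) over $V$; $\mathrm{Sym}_0(V)=\{\emptyset\}$ (empty word) and $\mathrm{Sym}_1(V)=V$. For $\alpha\in\mathrm{Sym}_i(V)$, $\beta\in\mathrm{Sym}_j(V)$, $\alpha\cdot\beta\in\mathrm{Sym}_{i+j}(V)$ is the concatenation; $A\cdot B=\{\alpha\cdot\beta:\alpha\in A,\beta\in B\}$ and $\alpha\cdot B=\{\alpha\}\cdot B$. For a matroid $M$ on $V$: $r_M$ is the rank function, $\operatorname{rank}M=r_M(V)$, $\mathrm{cl}_M$ is the closure operator, $M^*$ is the dual, $L_M$ is the set of loops, $M|_X$ is the restriction to $X$. Weak order with relabelling: for matroids $M_1=(V_1,r_1)$, $M_2=(V_2,r_2)$ and a bijection $f:V_2\to V_1$, $M_1\preceq_{\rm w}M_2$ via $f$ means $r_1(f(X))\le r_2(X)$ for all $X\subseteq V_2$. Properties of $N$ (a matroid on $\mathrm{Sym}_k(V)$) with respect to $M$: - SP-rank Property: $\operatorname{rank}N=\binom{\operatorname{rank}M+k-1}{k}$.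 - Strong SP-rank Property: for all $X\subseteq V$, $r_N(X\cdot\mathrm{Sym}_{k-1}(V))=\binom{\operatorname{rank}M+k-1}{k}-\binom{\operatorname{rank}M-r_M(X)+k-1}{k}$. - Flat Property: for every flat $F$ of $M$, $F\cdot\mathrm{Sym}_{k-1}(V)$ is a flat of $N$. - Closure Property: for all $X\subseteq V$, $\mathrm{cl}_M(X)\cdot\mathrm{Sym}_{k-1}(V)\subseteq\mathrm{cl}_N(X\cdot\mathrm{Sym}_{k-1}(V))$. - Weak Order Multilinearity: for all $\tau\in\mathrm{Sym}_{k-1}(V\setminus L_M)$, $M^*\preceq_{\rm w}(N|_{\tau\cdot V})^*$ via the bijection $\tau\cdot v\mapsto v$; and $\tau\cdot v$ is a loop of $N$ for all $\tau\in\mathrm{Sym}_{k-1}(V)$, $v\in L_M$. *)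

theory Defs
  imports Main "HOL-Library.Multiset"
begin

(* Matroids are given by a ground set and a rank function. The rank function is total on sets,
   but only its values on subsets of the ground set carry meaning. *)

record 'a matroid_data =
  ground :: "'a set"
  rk :: "'a set \<Rightarrow> nat"

definition matroid :: "'a matroid_data \<Rightarrow> bool" where
  "matroid M \<longleftrightarrow>
     finite (ground M) \<and>
     (\<forall>X \<subseteq> ground M. rk M X \<le> card X) \<and>
     (\<forall>X Y. X \<subseteq> Y \<and> Y \<subseteq> ground M \<longrightarrow> rk M X \<le> rk M Y) \<and>
     (\<forall>X Y. X \<subseteq> ground M \<and> Y \<subseteq> ground M \<longrightarrow>
        rk M (X \<union> Y) + rk M (X \<inter> Y) \<le> rk M X + rk M Y)"

definition matroid_rank :: "'a matroid_data \<Rightarrow> nat" where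
  "matroid_rank M = rk M (ground M)"

definition cl :: "'a matroid_data \<Rightarrow> 'a set \<Rightarrow> 'a set" where
  "cl M X = {v \<in> ground M. rk M (insert v X) = rk M X}"

definition flat :: "'a matroid_data \<Rightarrow> 'a set \<Rightarrow> bool" where
  "flat M F \<longleftrightarrow> F \<subseteq> ground M \<and> cl M F = F"

definition loops :: "'a matroid_data \<Rightarrow> 'a set" where
  "loops M = {v \<in> ground M. rk M {v} = 0}"

(* The natural-number subtraction is exact: in a matroid,
   rk M (ground M) \<le> rk M (ground M - X) + card X for X \<subseteq> ground M. *)
definition dual :: "'a matroid_data \<Rightarrow> 'a matroid_data" where
  "dual M = \<lparr> ground = ground M,
              rk = (\<lambda>X. card X + rk M (ground M - X) - rk M (ground M)) \<rparr>"

definition restriction :: "'a matroid_data \<Rightarrow> 'a set \<Rightarrow> 'a matroid_data" where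
  "restriction M X = \<lparr> ground = X, rk = rk M \<rparr>"

definition weak_le_via :: "'a matroid_data \<Rightarrow> 'b matroid_data \<Rightarrow> ('b \<Rightarrow> 'a) \<Rightarrow> bool" where
  "weak_le_via M1 M2 f \<longleftrightarrow>
     bij_betw f (ground M2) (ground M1) \<and>
     (\<forall>X \<subseteq> ground M2. rk M1 (f ` X) \<le> rk M2 X)"

(* Unordered words over V are multisets, and concatenation is multiset sum.
   A set of letters X, used as a factor, is identified with Sym 1 X. *)

abbreviation Sym :: "nat \<Rightarrow> 'a set \<Rightarrow> 'a multiset set" where
  "Sym k V \<equiv> multisets_of_size V k"

definition word_prod :: "'a multiset set \<Rightarrow> 'a multiset set \<Rightarrow> 'a multiset set" where
  "word_prod A B = {\<alpha> + \<beta> | \<alpha> \<beta>. \<alpha> \<in> A \<and> \<beta> \<in> B}"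

definition sp_rank_property :: "nat \<Rightarrow> 'a matroid_data \<Rightarrow> 'a multiset matroid_data \<Rightarrow> bool" where
  "sp_rank_property k M N \<longleftrightarrow> matroid_rank N = (matroid_rank M + k - 1) choose k"

definition strong_sp_rank_property ::
    "nat \<Rightarrow> 'a matroid_data \<Rightarrow> 'a multiset matroid_data \<Rightarrow> bool" where
  "strong_sp_rank_property k M N \<longleftrightarrow>
     (\<forall>X \<subseteq> ground M.
        rk N (word_prod (Sym 1 X) (Sym (k - 1) (ground M))) =
          ((matroid_rank M + k - 1) choose k) - ((matroid_rank M - rk M X + k - 1) choose k))"

definition flat_property :: "nat \<Rightarrow> 'a matroid_data \<Rightarrow> 'a multiset matroid_data \<Rightarrow> bool" where
  "flat_property k M N \<longleftrightarrow>
     (\<forall>F. flat M F \<longrightarrow> flat N (word_prod (Sym 1 F) (Sym (k - 1) (ground M))))"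

definition closure_property :: "nat \<Rightarrow> 'a matroid_data \<Rightarrow> 'a multiset matroid_data \<Rightarrow> bool" where
  "closure_property k M N \<longleftrightarrow>
     (\<forall>X \<subseteq> ground M.
        word_prod (Sym 1 (cl M X)) (Sym (k - 1) (ground M))
          \<subseteq> cl N (word_prod (Sym 1 X) (Sym (k - 1) (ground M))))"

(* The inv_into term is the bijection \<tau> + {#v#} \<mapsto> v. *)
definition weak_order_multilinearity ::
    "nat \<Rightarrow> 'a matroid_data \<Rightarrow> 'a multiset matroid_data \<Rightarrow> bool" where
  "weak_order_multilinearity k M N \<longleftrightarrow>
     (\<forall>\<tau> \<in> Sym (k - 1) (ground M - loops M).
        weak_le_via (dual M) (dual (restriction N (word_prod {\<tau>} (Sym 1 (ground M)))))
          (inv_into (ground M) (\<lambda>v. \<tau> + {#v#}))) \<and>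
     (\<forall>\<tau> \<in> Sym (k - 1) (ground M). \<forall>v \<in> loops M. \<tau> + {#v#} \<in> loops N)"

end

theory Submission
  imports Defs
begin

text \<open>
  Weak Order Multilinearity says that \<open>\<tau> \<cdot> B\<close> spans \<open>\<tau> \<cdot> V\<close> in \<open>N\<close> for every basis \<open>B\<close> of \<open>M\<close>. Exchanging
  letters one at a time, \<open>\<sigma> \<cdot> Sym m B\<close> spans \<open>\<sigma> \<cdot> Sym m V\<close>, so under the SP-rank Property \<open>Sym k B\<close> is
  a basis of \<open>N\<close> for every \<open>B\<close>. If \<open>I \<subseteq> B\<close> is a basis of \<open>X\<close>, the Closure Property makes the words
  over \<open>B\<close> that meet \<open>I\<close> a basis of \<open>X \<cdot> Sym (k - 1) V\<close>; counting them gives the Strong SP-rank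
  Property. Conversely, that property shows that the rank of \<open>X \<cdot> Sym (k - 1) V\<close> does not change when
  \<open>X\<close> is replaced by its closure. For a flat \<open>F\<close> with basis \<open>I \<subseteq> B\<close>, induction on the length of a word
  \<open>\<sigma>\<close> over \<open>V - F\<close> shows that \<open>\<sigma> \<cdot> Sym m (B - I)\<close> stays independent after contracting
  \<open>F \<cdot> Sym (k - 1) V\<close>: to append \<open>v\<close> to \<open>\<sigma>\<close>, change \<open>B\<close> into a basis containing \<open>v\<close>.
\<close>

section \<open>Closure, bases and relative independence from the rank axioms\<close>

locale rank_matroid =
  fixes M :: "'a matroid_data"
  assumes matroid: "matroid M"
begin

lemma finite_ground: "finite (ground M)"
  using matroid by (simp add: matroid_def)

lemma finite_subset_ground: "X \<subseteq> ground M \<Longrightarrow> finite X"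
  using finite_ground finite_subset by blast

lemma rk_le_card: "X \<subseteq> ground M \<Longrightarrow> rk M X \<le> card X"
  using matroid by (simp add: matroid_def)

lemma rk_mono: "X \<subseteq> Y \<Longrightarrow> Y \<subseteq> ground M \<Longrightarrow> rk M X \<le> rk M Y"
  using matroid by (simp add: matroid_def)

lemma rk_submodular:
  "X \<subseteq> ground M \<Longrightarrow> Y \<subseteq> ground M \<Longrightarrow> rk M (X \<union> Y) + rk M (X \<inter> Y) \<le> rk M X + rk M Y"
  using matroid by (simp add: matroid_def)

lemma rk_Un_le_card:
  assumes "X \<subseteq> ground M" "Y \<subseteq> ground M"
  shows "rk M (X \<union> Y) \<le> rk M X + card Y"
  using rk_submodular[OF assms] rk_le_card[OF assms(2)] by linarith

lemma cl_subset_ground: "cl M X \<subseteq> ground M"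
  by (auto simp: cl_def)

lemma subset_cl: "X \<subseteq> ground M \<Longrightarrow> X \<subseteq> cl M X"
  by (auto simp: cl_def insert_absorb)

text \<open>Submodularity gives diminishing returns: an element that adds nothing to the rank of
  \<open>X\<close> adds nothing to the rank of a larger set.\<close>

lemma cl_mono:
  assumes "X \<subseteq> Y" "Y \<subseteq> ground M"
  shows "cl M X \<subseteq> cl M Y"
proof
  fix v assume v: "v \<in> cl M X"
  then have vE: "v \<in> ground M" by (simp add: cl_def)
  have "rk M (insert v X \<union> Y) + rk M (insert v X \<inter> Y) \<le> rk M (insert v X) + rk M Y"
    using assms vE by (intro rk_submodular) auto
  moreover have "insert v X \<union> Y = insert v Y" using assms by auto
  moreover have "rk M X \<le> rk M (insert v X \<inter> Y)" using assms by (intro rk_mono) auto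
  moreover have "rk M Y \<le> rk M (insert v Y)" using assms vE by (intro rk_mono) auto
  ultimately show "v \<in> cl M Y" using v vE by (simp add: cl_def)
qed

lemma rk_Un_subset_cl:
  assumes "X \<subseteq> ground M" "A \<subseteq> cl M X"
  shows "rk M (X \<union> A) = rk M X"
proof -
  have "finite A" using assms(2) cl_subset_ground finite_subset_ground by blast
  then show ?thesis using assms(2)
  proof (induction A rule: finite_induct)
    case (insert a A)
    have "X \<union> A \<subseteq> ground M" using assms(1) insert.prems cl_subset_ground by blast
    then have "a \<in> cl M (X \<union> A)" using cl_mono[of X "X \<union> A"] insert.prems by blast
    then show ?case using insert by (simp add: cl_def)
  qed simp
qed

lemma rk_eq_of_subset_cl:
  assumes "X \<subseteq> Y" "Y \<subseteq> cl M X" "X \<subseteq> ground M"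
  shows "rk M Y = rk M X"
  using rk_Un_subset_cl[OF assms(3,2)] assms(1) by (simp add: Un_absorb1)

lemma rk_cl: "X \<subseteq> ground M \<Longrightarrow> rk M (cl M X) = rk M X"
  by (simp add: rk_eq_of_subset_cl subset_cl)

lemma subset_cl_of_rk_le:
  assumes "X \<subseteq> Y" "Y \<subseteq> ground M" "rk M Y \<le> rk M X"
  shows "Y \<subseteq> cl M X"
proof
  fix v assume v: "v \<in> Y"
  have "rk M X \<le> rk M (insert v X)" "rk M (insert v X) \<le> rk M Y"
    using assms v by (auto intro!: rk_mono)
  then show "v \<in> cl M X" using assms v by (auto simp: cl_def)
qed

lemma cl_subset_cl:
  assumes "A \<subseteq> cl M X" "X \<subseteq> ground M"
  shows "cl M A \<subseteq> cl M X"
proof -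
  have "cl M A \<subseteq> cl M (cl M X)" by (rule cl_mono[OF assms(1) cl_subset_ground])
  also have "\<dots> \<subseteq> cl M X"
  proof (rule subset_cl_of_rk_le)
    show "X \<subseteq> cl M (cl M X)"
      using subset_cl[OF assms(2)] subset_cl[OF cl_subset_ground] by blast
    show "rk M (cl M (cl M X)) \<le> rk M X"
      using rk_cl[OF assms(2)] rk_cl[OF cl_subset_ground[of X]] by simp
  qed (rule cl_subset_ground)
  finally show ?thesis .
qed

lemma loop_in_cl:
  assumes "v \<in> loops M" "X \<subseteq> ground M"
  shows "v \<in> cl M X"
proof -
  have "rk M {} = 0" using rk_le_card[of "{}"] by simp
  then have "v \<in> cl M {}" using assms(1) by (simp add: loops_def cl_def)
  then show ?thesis using cl_mono[of "{}" X] assms(2) by blast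
qed

text \<open>The rank equation expresses, without a contraction operation, that \<open>T\<close> is
  independent after contracting \<open>S\<close>. Removing \<open>T - T'\<close> lowers the rank by
  at most its cardinality, so the upper bound for \<open>T'\<close> is attained as well.\<close>

lemma independent_over_subset:
  assumes "rk M (S \<union> T) = rk M S + card T" "T' \<subseteq> T" "S \<subseteq> ground M" "T \<subseteq> ground M"
  shows "rk M (S \<union> T') = rk M S + card T'"
proof (rule antisym)
  show "rk M (S \<union> T') \<le> rk M S + card T'" using assms by (intro rk_Un_le_card) auto
  have "rk M (S \<union> T' \<union> (T - T')) \<le> rk M (S \<union> T') + card (T - T')"
    using assms by (intro rk_Un_le_card) auto
  moreover have "S \<union> T' \<union> (T - T') = S \<union> T" using assms(2) by auto
  moreover have "card T = card T' + card (T - T')"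
    using assms(2,4) finite_subset_ground[of T]
    by (metis card_Diff_subset card_mono finite_subset le_add_diff_inverse)
  ultimately show "rk M S + card T' \<le> rk M (S \<union> T')" using assms(1) by simp
qed

lemma independent_subset:
  assumes "rk M T = card T" "T' \<subseteq> T" "T \<subseteq> ground M"
  shows "rk M T' = card T'"
  using independent_over_subset[of "{}" T T'] rk_le_card[of "{}"] assms by simp

text \<open>A maximal independent set between \<open>I\<close> and \<open>X\<close> spans
  \<open>X\<close>, since any element of \<open>X\<close> outside its closure could be added to
  it.\<close>

lemma extend_to_basis:
  assumes "I \<subseteq> X" "X \<subseteq> ground M" "rk M I = card I"
  obtains B where "I \<subseteq> B" "B \<subseteq> X" "rk M B = card B" "rk M B = rk M X"
proof -
  let ?P = "\<lambda>B. I \<subseteq> B \<and> B \<subseteq> X \<and> rk M B = card B"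
  have "finite {B. ?P B}"
    by (rule finite_subset[of _ "Pow X"]) (use assms finite_subset_ground in auto)
  moreover have "{B. ?P B} \<noteq> {}" using assms by auto
  ultimately obtain B where B: "?P B" and max: "\<And>B'. ?P B' \<Longrightarrow> B \<subseteq> B' \<Longrightarrow> B = B'"
    using finite_has_maximal[of "{B. ?P B}"] by auto
  have finB: "finite B" using B assms(2) finite_subset_ground by blast
  have "X \<subseteq> cl M B"
  proof
    fix v assume v: "v \<in> X"
    show "v \<in> cl M B"
    proof (rule ccontr)
      assume "v \<notin> cl M B"
      then have ne: "rk M (insert v B) \<noteq> rk M B" using v assms(2) by (auto simp: cl_def)
      then have "v \<notin> B" by (auto simp: insert_absorb)
      moreover have "rk M B \<le> rk M (insert v B)" using v B assms(2) by (intro rk_mono) auto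
      moreover have "rk M (insert v B) \<le> card (insert v B)"
        using v B assms(2) by (intro rk_le_card) auto
      ultimately have "?P (insert v B)" using ne B v finB by auto
      then show False using max[of "insert v B"] \<open>v \<notin> B\<close> by blast
    qed
  qed
  then have "rk M X = rk M B" using B assms(2) by (intro rk_eq_of_subset_cl) auto
  then show thesis by (intro that[of B]) (use B in auto)
qed

lemma basis_of_subset:
  assumes "X \<subseteq> ground M"
  obtains I B where "I \<subseteq> X" "rk M I = card I" "rk M I = rk M X"
    "I \<subseteq> B" "B \<subseteq> ground M" "rk M B = card B" "rk M B = matroid_rank M"
proof -
  obtain I where I: "I \<subseteq> X" "rk M I = card I" "rk M I = rk M X"
    using extend_to_basis[of "{}" X] assms rk_le_card[of "{}"] by auto
  obtain B where "I \<subseteq> B" "B \<subseteq> ground M" "rk M B = card B" "rk M B = matroid_rank M"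
    using extend_to_basis[of I "ground M"] assms I by (auto simp: matroid_rank_def)
  then show thesis using that I by blast
qed

end

section \<open>Words that contain a letter of a given set\<close>

locale multilinear_weak_order = M: rank_matroid M + N: rank_matroid N
  for k :: nat and M :: "'a matroid_data" and N :: "'a multiset matroid_data" +
  assumes k_pos: "k \<ge> 1"
    and ground_N: "ground N = Sym k (ground M)"
    and wom: "weak_order_multilinearity k M N"
begin

abbreviation V :: "'a set" where "V \<equiv> ground M"

definition basis :: "'a set \<Rightarrow> bool" where
  "basis B \<longleftrightarrow> B \<subseteq> V \<and> rk M B = card B \<and> rk M B = matroid_rank M"

text \<open>For \<open>X\<close> inside \<open>V\<close>, a word factors as a letter of
  \<open>X\<close> times a word of length \<open>k - 1\<close> exactly when a letter of
  \<open>X\<close> occurs in it. Membership can thus be tested on the support, without choosing a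
  factorisation.\<close>

definition meeting :: "'a set \<Rightarrow> 'a multiset set" where
  "meeting X = {w \<in> Sym k V. set_mset w \<inter> X \<noteq> {}}"

lemma word_prod_eq_meeting:
  assumes "X \<subseteq> V"
  shows "word_prod (Sym 1 X) (Sym (k - 1) V) = meeting X"
proof (intro set_eqI iffI)
  fix w assume "w \<in> word_prod (Sym 1 X) (Sym (k - 1) V)"
  then obtain \<alpha> \<beta> where "w = \<alpha> + \<beta>" "set_mset \<alpha> \<subseteq> X" "size \<alpha> = 1" "set_mset \<beta> \<subseteq> V" "size \<beta> = k - 1"
    by (auto simp: word_prod_def multisets_of_size_def)
  moreover from this obtain v where "\<alpha> = {#v#}" using size_1_singleton_mset by blast
  ultimately show "w \<in> meeting X"
    using assms k_pos by (auto simp: meeting_def multisets_of_size_def)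
next
  fix w assume w: "w \<in> meeting X"
  then obtain v where v: "v \<in># w" "v \<in> X" by (auto simp: meeting_def)
  then obtain \<beta> where \<beta>: "w = {#v#} + \<beta>" by (metis add_mset_add_single mset_add union_commute)
  then have "{#v#} \<in> Sym 1 X" "\<beta> \<in> Sym (k - 1) V"
    using v w by (auto simp: meeting_def multisets_of_size_def)
  then show "w \<in> word_prod (Sym 1 X) (Sym (k - 1) V)" using \<beta> unfolding word_prod_def by blast
qed

lemma meeting_subset: "meeting X \<subseteq> ground N"
  by (auto simp: meeting_def ground_N)

lemma meeting_mono: "X \<subseteq> Y \<Longrightarrow> meeting X \<subseteq> meeting Y"
  by (auto simp: meeting_def)

lemma meeting_ground: "meeting V = ground N"
proof -
  have "set_mset w \<inter> V \<noteq> {}" if "w \<in> Sym k V" for w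
    using that k_pos by (auto simp: multisets_of_size_def Int_absorb2)
  then show ?thesis by (auto simp: meeting_def ground_N)
qed

lemma Sym_subset_ground: "B \<subseteq> V \<Longrightarrow> Sym k B \<subseteq> ground N"
  by (simp add: ground_N multisets_of_size_mono)

lemma shift_Sym_subset_ground:
  assumes "set_mset \<sigma> \<subseteq> V" "size \<sigma> + m = k" "B \<subseteq> V"
  shows "(+) \<sigma> ` Sym m B \<subseteq> ground N"
proof
  fix w assume "w \<in> (+) \<sigma> ` Sym m B"
  then obtain \<beta> where "w = \<sigma> + \<beta>" "set_mset \<beta> \<subseteq> B" "size \<beta> = m"
    by (auto simp: multisets_of_size_def)
  moreover from this have "set_mset \<beta> \<subseteq> V" using assms(3) by blast
  ultimately show "w \<in> ground N" using assms by (simp add: ground_N multisets_of_size_def)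
qed

section \<open>Exchanging letters by Weak Order Multilinearity\<close>

lemma loop_word_in_loops:
  assumes "w \<in> ground N" "v \<in># w" "v \<in> loops M"
  shows "w \<in> loops N"
proof -
  obtain \<tau> where \<tau>: "w = \<tau> + {#v#}" using assms(2) by (metis add_mset_add_single mset_add)
  then have "\<tau> \<in> Sym (k - 1) V" using assms(1) by (auto simp: ground_N multisets_of_size_def)
  then show ?thesis using wom assms(3) \<tau> by (auto simp: weak_order_multilinearity_def)
qed

text \<open>The complement of the basis \<open>B\<close> is independent in the dual of
  \<open>M\<close>. The weak order makes the words \<open>\<tau> + {#v#}\<close> with
  \<open>v\<close> in \<open>V - B\<close> independent in the dual of the restriction of
  \<open>N\<close>, so the remaining words, those with last letter in \<open>B\<close>, span all of
  them.\<close>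

lemma append_letter_in_cl:
  assumes \<tau>: "\<tau> \<in> Sym (k - 1) (V - loops M)" and B: "basis B" and v: "v \<in> V"
  shows "\<tau> + {#v#} \<in> cl N ((\<lambda>b. \<tau> + {#b#}) ` B)"
proof -
  let ?g = "\<lambda>v. \<tau> + {#v#}"
  let ?f = "inv_into V ?g"
  let ?R = "restriction N (word_prod {\<tau>} (Sym 1 V))"
  have BV: "B \<subseteq> V" and rB: "rk M B = rk M V"
    using B by (auto simp: basis_def matroid_rank_def)
  have inj: "inj_on ?g A" for A by (auto simp: inj_on_def)
  have gV: "word_prod {\<tau>} (Sym 1 V) = ?g ` V"
  proof (intro set_eqI iffI)
    fix w assume "w \<in> word_prod {\<tau>} (Sym 1 V)"
    then obtain \<beta> where "w = \<tau> + \<beta>" "set_mset \<beta> \<subseteq> V" "size \<beta> = 1"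
      by (auto simp: word_prod_def multisets_of_size_def)
    then show "w \<in> ?g ` V" using size_1_singleton_mset[of \<beta>] by auto
  next
    fix w assume "w \<in> ?g ` V"
    then obtain v where "w = \<tau> + {#v#}" "{#v#} \<in> Sym 1 V" by (auto simp: multisets_of_size_def)
    then show "w \<in> word_prod {\<tau>} (Sym 1 V)" unfolding word_prod_def by blast
  qed
  have sub: "?g ` A \<subseteq> ground N" if "A \<subseteq> V" for A
    using that \<tau> k_pos by (auto simp: ground_N multisets_of_size_def)
  have "weak_le_via (dual M) (dual ?R) ?f"
    using wom \<tau> by (auto simp: weak_order_multilinearity_def)
  moreover have "?g ` (V - B) \<subseteq> ground (dual ?R)" unfolding dual_def restriction_def gV by auto
  ultimately have "rk (dual M) (?f ` ?g ` (V - B)) \<le> rk (dual ?R) (?g ` (V - B))"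
    by (auto simp: weak_le_via_def)
  moreover have "?f ` ?g ` (V - B) = V - B"
    by (rule inv_into_image_cancel[OF inj]) auto
  moreover have "V - (V - B) = B" using BV by auto
  moreover have "?g ` V - ?g ` (V - B) = ?g ` B" using BV by auto
  ultimately have le: "card (V - B) \<le> card (V - B) + rk N (?g ` B) - rk N (?g ` V)"
    unfolding dual_def restriction_def gV
    by (simp del: union_mset_add_mset_right add: rB card_image[OF inj])
  \<comment> \<open>If \<open>V - B\<close> is nonempty, the left side of \<open>le\<close> is
    positive, so the subtraction there is not truncated and the ranks can be compared. If
    \<open>V - B\<close> is empty, \<open>le\<close> carries no information, but then
    \<open>B = V\<close>.\<close>
  have "rk N (?g ` V) \<le> rk N (?g ` B)"
  proof (cases "V - B = {}")
    case True
    then show ?thesis using BV by (simp add: subset_antisym)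
  next
    case False
    then have "card (V - B) > 0" using M.finite_ground by (simp add: card_gt_0_iff)
    then show ?thesis using le by linarith
  qed
  then have "?g ` V \<subseteq> cl N (?g ` B)"
    using BV sub by (intro N.subset_cl_of_rk_le) auto
  then show ?thesis using v by blast
qed

text \<open>Here \<open>\<beta>\<close> holds the letters still to be exchanged and
  \<open>\<gamma>\<close> those already in \<open>B\<close>. A word ending in the letter
  \<open>v\<close> of \<open>\<beta>\<close> is spanned by the words with \<open>v\<close> replaced
  by a letter of \<open>B\<close>, and these have a shorter \<open>\<beta>\<close>; spanning is
  transitive.\<close>

lemma exchange_letters:
  assumes B: "basis B" and \<sigma>: "set_mset \<sigma> \<subseteq> V"
  shows "set_mset \<beta> \<subseteq> V \<Longrightarrow> set_mset \<gamma> \<subseteq> B \<Longrightarrow> size \<sigma> + size \<beta> + size \<gamma> = k \<Longrightarrow>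
    \<sigma> + \<beta> + \<gamma> \<in> cl N ((+) \<sigma> ` Sym (k - size \<sigma>) B)"
proof (induction \<beta> arbitrary: \<gamma>)
  case empty
  let ?T = "(+) \<sigma> ` Sym (k - size \<sigma>) B"
  have "?T \<subseteq> ground N"
    using \<sigma> B empty by (intro shift_Sym_subset_ground) (auto simp: basis_def)
  moreover have "\<sigma> + \<gamma> \<in> ?T" using empty by (auto simp: multisets_of_size_def)
  ultimately show ?case using N.subset_cl by auto
next
  case (add v \<beta>)
  let ?T = "(+) \<sigma> ` Sym (k - size \<sigma>) B"
  let ?\<tau> = "\<sigma> + \<beta> + \<gamma>"
  have BV: "B \<subseteq> V" using B by (simp add: basis_def)
  have T: "?T \<subseteq> ground N" using \<sigma> BV add.prems by (intro shift_Sym_subset_ground) auto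
  have w: "\<sigma> + add_mset v \<beta> + \<gamma> = ?\<tau> + {#v#}" by simp
  have wN: "?\<tau> + {#v#} \<in> ground N"
    using \<sigma> BV add.prems by (auto simp: ground_N multisets_of_size_def)
  \<comment> \<open>The exchange of the last letter is available only for a loop-free prefix
    \<open>?\<tau>\<close>. If \<open>?\<tau>\<close> contains a loop of \<open>M\<close>, the whole
    word is a loop of \<open>N\<close> and lies in every closure.\<close>
  show ?case
  proof (cases "set_mset ?\<tau> \<inter> loops M = {}")
    case False
    then have "?\<tau> + {#v#} \<in> loops N" using loop_word_in_loops[OF wN] by auto
    then show ?thesis using N.loop_in_cl[OF _ T] w by simp
  next
    case True
    then have "?\<tau> \<in> Sym (k - 1) (V - loops M)"
      using \<sigma> BV add.prems by (auto simp: multisets_of_size_def)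
    then have "?\<tau> + {#v#} \<in> cl N ((\<lambda>b. ?\<tau> + {#b#}) ` B)"
      using append_letter_in_cl[OF _ B] add.prems by auto
    moreover have "(\<lambda>b. ?\<tau> + {#b#}) ` B \<subseteq> cl N ?T"
    proof
      fix x assume "x \<in> (\<lambda>b. ?\<tau> + {#b#}) ` B"
      then obtain b where b: "b \<in> B" "x = ?\<tau> + {#b#}" by blast
      have "\<sigma> + \<beta> + add_mset b \<gamma> \<in> cl N ?T" using add b by (intro add.IH) auto
      then show "x \<in> cl N ?T" using b by simp
    qed
    ultimately show ?thesis using N.cl_subset_cl[OF _ T] w by auto
  qed
qed

lemma shift_Sym_subset_cl:
  assumes "basis B" "set_mset \<sigma> \<subseteq> V" "size \<sigma> + m = k"
  shows "(+) \<sigma> ` Sym m V \<subseteq> cl N ((+) \<sigma> ` Sym m B)"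
proof
  fix w assume "w \<in> (+) \<sigma> ` Sym m V"
  then obtain \<beta> where "w = \<sigma> + \<beta> + {#}" "set_mset \<beta> \<subseteq> V" "size \<beta> = m"
    by (auto simp: multisets_of_size_def)
  moreover have "m = k - size \<sigma>" using assms(3) by simp
  ultimately show "w \<in> cl N ((+) \<sigma> ` Sym m B)"
    using exchange_letters[OF assms(1,2), of \<beta> "{#}"] assms(3) by auto
qed

section \<open>Words over a basis of \<open>M\<close> as a basis of \<open>N\<close>\<close>

lemma card_Sym: "B \<subseteq> V \<Longrightarrow> card (Sym m B) = (card B + m - 1) choose m"
  by (simp add: card_multisets_of_size M.finite_subset_ground)

lemma rk_Sym_basis:
  assumes "basis B"
  shows "rk N (Sym k B) = matroid_rank N"
proof -
  have "B \<subseteq> V" using assms by (simp add: basis_def)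
  then have "Sym k B \<subseteq> ground N" by (rule Sym_subset_ground)
  moreover have "ground N \<subseteq> cl N (Sym k B)"
    using shift_Sym_subset_cl[OF assms, of "{#}" k] by (simp add: ground_N)
  ultimately show ?thesis unfolding matroid_rank_def
    using N.rk_eq_of_subset_cl by simp
qed

text \<open>A spanning set whose cardinality equals the rank is independent, and the SP-rank
  Property sets the rank of \<open>N\<close> to the number of words of length \<open>k\<close> over
  \<open>B\<close>.\<close>

lemma Sym_basis_independent:
  assumes "sp_rank_property k M N" "basis B"
  shows "rk N (Sym k B) = card (Sym k B)"
proof -
  have "B \<subseteq> V" "card B = matroid_rank M" using assms(2) by (auto simp: basis_def)
  then show ?thesis
    using assms(1) rk_Sym_basis[OF assms(2)] by (simp add: sp_rank_property_def card_Sym)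
qed

section \<open>The Strong SP-rank Property: its characterisation and the Flat Property\<close>

lemma strong_sp_rank_iff_meeting:
  "strong_sp_rank_property k M N \<longleftrightarrow>
    (\<forall>X \<subseteq> V. rk N (meeting X) =
      ((matroid_rank M + k - 1) choose k) - ((matroid_rank M - rk M X + k - 1) choose k))"
  unfolding strong_sp_rank_property_def by (metis word_prod_eq_meeting)

lemma sp_rank_of_strong:
  assumes "strong_sp_rank_property k M N"
  shows "sp_rank_property k M N"
proof -
  have "rk N (meeting V) =
      ((matroid_rank M + k - 1) choose k) - ((matroid_rank M - rk M V + k - 1) choose k)"
    using assms strong_sp_rank_iff_meeting by blast
  \<comment> \<open>For \<open>X = V\<close> the subtracted binomial is this one, and
    \<open>k \<ge> 1\<close> makes it vanish.\<close>
  moreover have "(k - 1) choose k = 0" using k_pos by (intro binomial_eq_0) auto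
  ultimately show ?thesis
    unfolding sp_rank_property_def meeting_ground matroid_rank_def
    by (metis diff_self_eq_0 add_0 diff_zero)
qed

text \<open>The prescribed rank depends on \<open>X\<close> only through its rank in
  \<open>M\<close>, which closure preserves; nested sets of equal rank span each other.\<close>

lemma closure_of_strong:
  assumes "strong_sp_rank_property k M N"
  shows "closure_property k M N"
  unfolding closure_property_def
proof (intro allI impI)
  fix X assume X: "X \<subseteq> V"
  have "meeting (cl M X) \<subseteq> cl N (meeting X)"
  proof (rule N.subset_cl_of_rk_le)
    show "meeting X \<subseteq> meeting (cl M X)" by (simp add: M.subset_cl X meeting_mono)
    show "rk N (meeting (cl M X)) \<le> rk N (meeting X)"
      using assms X M.cl_subset_ground[of X] by (simp add: strong_sp_rank_iff_meeting M.rk_cl)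
  qed (rule meeting_subset)
  then show "word_prod (Sym 1 (cl M X)) (Sym (k - 1) V)
      \<subseteq> cl N (word_prod (Sym 1 X) (Sym (k - 1) V))"
    by (subst (1 2) word_prod_eq_meeting) (use X M.cl_subset_ground in auto)
qed

lemma strong_of_sp_rank_closure:
  assumes sp: "sp_rank_property k M N" and closure: "closure_property k M N"
  shows "strong_sp_rank_property k M N"
  unfolding strong_sp_rank_iff_meeting
proof (intro allI impI)
  fix X assume X: "X \<subseteq> V"
  obtain I B where I: "I \<subseteq> X" "rk M I = card I" "rk M I = rk M X"
    and IB: "I \<subseteq> B" and "B \<subseteq> V" "rk M B = card B" "rk M B = matroid_rank M"
    using M.basis_of_subset[OF X] by metis
  then have B: "basis B" and BV: "B \<subseteq> V" and cardB: "card B = matroid_rank M"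
    by (auto simp: basis_def)
  have IV: "I \<subseteq> V" using I X by auto
  \<comment> \<open>The words over \<open>B\<close> that use a letter of \<open>I\<close>. They are
    independent as part of \<open>Sym k B\<close>, so it remains to show that they span
    \<open>meeting X\<close> and to count them.\<close>
  let ?W = "Sym k B - Sym k (B - I)"
  have W: "?W \<subseteq> meeting I" using BV by (auto simp: meeting_def multisets_of_size_def)
  have WN: "?W \<subseteq> ground N" using W meeting_subset by blast
  have "meeting I \<subseteq> cl N ?W"
  proof
    fix w assume w: "w \<in> meeting I"
    then obtain v where v: "v \<in># w" "v \<in> I" by (auto simp: meeting_def)
    then obtain \<beta> where \<beta>: "w = {#v#} + \<beta>" by (metis add_mset_add_single mset_add union_commute)
    have "\<beta> \<in> Sym (k - 1) V" using w \<beta> by (auto simp: meeting_def multisets_of_size_def)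
    then have "w \<in> (+) {#v#} ` Sym (k - 1) V" using \<beta> by blast
    \<comment> \<open>The letter \<open>v\<close> of \<open>I\<close> is kept as a fixed prefix
      while the others are exchanged for letters of \<open>B\<close>; every resulting word still
      meets \<open>I\<close>.\<close>
    also have "\<dots> \<subseteq> cl N ((+) {#v#} ` Sym (k - 1) B)"
      using v IV k_pos by (intro shift_Sym_subset_cl[OF B]) auto
    also have "\<dots> \<subseteq> cl N ?W"
    proof (rule N.cl_mono[OF _ WN], rule subsetI)
      fix x assume "x \<in> (+) {#v#} ` Sym (k - 1) B"
      then obtain \<gamma> where \<gamma>: "x = add_mset v \<gamma>" "set_mset \<gamma> \<subseteq> B" "size \<gamma> = k - 1"
        by (auto simp: multisets_of_size_def)
      then have "set_mset x \<subseteq> B" "\<not> set_mset x \<subseteq> B - I" "size x = k"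
        using v IB k_pos by auto
      then show "x \<in> ?W" by (simp add: multisets_of_size_def)
    qed
    finally show "w \<in> cl N ?W" .
  qed
  then have "rk N (meeting I) = rk N ?W" using N.rk_eq_of_subset_cl[OF W _ WN] by simp
  \<comment> \<open>The Closure Property enters here, applied to \<open>I\<close>, whose closure
    contains \<open>X\<close>.\<close>
  moreover have "rk N (meeting X) = rk N (meeting I)"
  proof (rule N.rk_eq_of_subset_cl)
    have "X \<subseteq> cl M I" using I X by (intro M.subset_cl_of_rk_le) auto
    then have "meeting X \<subseteq> meeting (cl M I)" by (rule meeting_mono)
    also have "\<dots> \<subseteq> cl N (meeting I)"
      using closure[unfolded closure_property_def, rule_format, OF IV]
      by (simp only: word_prod_eq_meeting[OF IV] word_prod_eq_meeting[OF M.cl_subset_ground])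
    finally show "meeting X \<subseteq> cl N (meeting I)" .
  qed (use I meeting_mono meeting_subset in auto)
  moreover have "rk N ?W = card ?W"
    by (rule N.independent_subset[OF Sym_basis_independent[OF sp B] _ Sym_subset_ground[OF BV]]) auto
  moreover have "card ?W = card (Sym k B) - card (Sym k (B - I))"
    using BV M.finite_subset_ground[of B]
    by (intro card_Diff_subset multisets_of_size_mono finite_multisets_of_size) auto
  moreover have "card (B - I) = matroid_rank M - rk M X"
    using IB I cardB IV M.finite_subset_ground[of I] by (simp add: card_Diff_subset)
  moreover have "B - I \<subseteq> V" using BV by auto
  ultimately show "rk N (meeting X) =
      ((matroid_rank M + k - 1) choose k) - ((matroid_rank M - rk M X + k - 1) choose k)"
    by (simp add: card_Sym BV cardB)
qed

text \<open>The case \<open>m = 0\<close> puts a word avoiding \<open>F\<close> outside the closure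
  of \<open>meeting F\<close>, which is what flatness requires. General \<open>m\<close> makes
  induction on the prefix \<open>\<sigma>\<close> possible, and \<open>B\<close> varies because
  appending a letter \<open>v\<close> calls for a basis containing \<open>v\<close>.\<close>

lemma contracted_shift_Sym_independent:
  assumes strong: "strong_sp_rank_property k M N"
    and F: "flat M F" and I: "I \<subseteq> F" "rk M I = card I" "rk M I = rk M F"
  shows "set_mset \<sigma> \<subseteq> V - F \<Longrightarrow> size \<sigma> + m = k \<Longrightarrow> basis B \<Longrightarrow> I \<subseteq> B \<Longrightarrow>
    rk N (meeting F \<union> (+) \<sigma> ` Sym m (B - I)) = rk N (meeting F) + card (Sym m (B - I))"
proof (induction \<sigma> arbitrary: m B)
  case empty
  have FV: "F \<subseteq> V" using F by (simp add: flat_def)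
  have BV: "B \<subseteq> V" and cardB: "card B = matroid_rank M" using empty by (auto simp: basis_def)
  have IV: "I \<subseteq> V" using I FV by auto
  have m: "m = k" using empty by simp
  \<comment> \<open>A word over \<open>B\<close> either meets \<open>I\<close>, hence
    \<open>F\<close>, or is a word over \<open>B - I\<close>. So this union has at least the rank of
    \<open>Sym k B\<close>, which is exactly the rank of \<open>meeting F\<close> plus the number of
    words over \<open>B - I\<close>.\<close>
  have "meeting F \<union> Sym k (B - I) \<subseteq> ground N"
    using meeting_subset Sym_subset_ground[of "B - I"] BV by auto
  moreover have "Sym k B \<subseteq> meeting F \<union> Sym k (B - I)"
    using I BV by (auto simp: meeting_def multisets_of_size_def)
  ultimately have "rk N (Sym k B) \<le> rk N (meeting F \<union> Sym k (B - I))"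
    by (intro N.rk_mono) auto
  then have ge: "((matroid_rank M + k - 1) choose k) \<le> rk N (meeting F \<union> Sym k (B - I))"
    using Sym_basis_independent[OF sp_rank_of_strong[OF strong] empty(3)] card_Sym[OF BV] cardB by simp
  have "card (B - I) = matroid_rank M - rk M F"
    using empty I cardB IV M.finite_subset_ground[of I] by (simp add: card_Diff_subset)
  then have card: "card (Sym k (B - I)) = (matroid_rank M - rk M F + k - 1) choose k"
    using card_Sym[of "B - I" k] BV by auto
  \<comment> \<open>This makes the natural-number subtraction in the Strong SP-rank formula
    exact.\<close>
  moreover have "(matroid_rank M - rk M F + k - 1) choose k \<le> (matroid_rank M + k - 1) choose k"
    by (intro binomial_right_mono) auto
  moreover have "rk N (meeting F) =
      ((matroid_rank M + k - 1) choose k) - ((matroid_rank M - rk M F + k - 1) choose k)"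
    using strong FV by (simp add: strong_sp_rank_iff_meeting)
  moreover have "rk N (meeting F \<union> Sym k (B - I)) \<le> rk N (meeting F) + card (Sym k (B - I))"
    using BV by (intro N.rk_Un_le_card meeting_subset Sym_subset_ground) auto
  ultimately show ?case using ge m by simp
next
  case (add v \<sigma>)
  let ?S = "meeting F"
  have FV: "F \<subseteq> V" using F by (simp add: flat_def)
  have v: "v \<in> V" "v \<notin> F" and \<sigma>: "set_mset \<sigma> \<subseteq> V - F" using add.prems by auto
  have vI: "v \<notin> I" using v I by auto
  have IV: "I \<subseteq> V" using I FV by auto
  \<comment> \<open>The flat \<open>F\<close> contains the closure of \<open>I\<close> but not
    \<open>v\<close>, so \<open>insert v I\<close> is independent and extends to a basis
    \<open>B'\<close>.\<close>
  have "v \<notin> cl M I" using M.cl_mono[OF I(1) FV] F v by (auto simp: flat_def)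
  then have "rk M (insert v I) \<noteq> rk M I" using v by (simp add: cl_def)
  moreover have "rk M I \<le> rk M (insert v I)" "rk M (insert v I) \<le> card (insert v I)"
    using v IV by (auto intro!: M.rk_mono M.rk_le_card)
  ultimately have "rk M (insert v I) = card (insert v I)"
    using I(2) vI M.finite_subset_ground[OF IV] by simp
  then obtain B' where "insert v I \<subseteq> B'" "B' \<subseteq> V" "rk M B' = card B'" "rk M B' = rk M V"
    using M.extend_to_basis[of "insert v I" V] v IV by auto
  then have B': "basis B'" and B'V: "B' \<subseteq> V" and IB': "I \<subseteq> B'" and vB': "v \<in> B' - I"
    using vI by (auto simp: basis_def matroid_rank_def)
  have BV: "B \<subseteq> V" using add.prems by (auto simp: basis_def)
  let ?u = "add_mset v \<sigma>"
  have u: "set_mset ?u \<subseteq> V" using v \<sigma> by auto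
  have sub: "(+) ?u ` Sym m A \<subseteq> ground N" if "A \<subseteq> V" for A
    using that u add.prems by (intro shift_Sym_subset_ground) auto
  have sub': "(+) \<sigma> ` Sym (Suc m) (B' - I) \<subseteq> ground N"
    using \<sigma> B'V add.prems by (intro shift_Sym_subset_ground) auto
  \<comment> \<open>The induction hypothesis is used for \<open>B'\<close> and words longer by one.
    Since \<open>v\<close> lies in \<open>B' - I\<close>, the words with prefix \<open>?u\<close>
    form a subfamily and inherit independence over \<open>?S\<close>.\<close>
  have "rk N (?S \<union> (+) \<sigma> ` Sym (Suc m) (B' - I)) = rk N ?S + card ((+) \<sigma> ` Sym (Suc m) (B' - I))"
    using add.IH[OF \<sigma> _ B' IB', of "Suc m"] add.prems by (simp add: card_image)
  moreover have "(+) ?u ` Sym m (B' - I) \<subseteq> (+) \<sigma> ` Sym (Suc m) (B' - I)"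
  proof
    fix w assume "w \<in> (+) ?u ` Sym m (B' - I)"
    then obtain \<beta> where \<beta>: "w = \<sigma> + add_mset v \<beta>" "\<beta> \<in> Sym m (B' - I)" by auto
    then have "add_mset v \<beta> \<in> Sym (Suc m) (B' - I)" using vB' by (auto simp: multisets_of_size_def)
    then show "w \<in> (+) \<sigma> ` Sym (Suc m) (B' - I)" using \<beta> by blast
  qed
  ultimately have "rk N (?S \<union> (+) ?u ` Sym m (B' - I)) = rk N ?S + card ((+) ?u ` Sym m (B' - I))"
    using N.independent_over_subset[OF _ _ meeting_subset sub'] by blast
  then have eq: "rk N (?S \<union> (+) ?u ` Sym m (B' - I)) = rk N ?S + card (Sym m (B' - I))"
    by (subst (asm) card_image) auto
  have "card B' = card B" using B' add.prems(3) by (metis basis_def)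
  then have "card (B' - I) = card (B - I)"
    using IB' add.prems(4) IV M.finite_subset_ground[of I] by (simp add: card_Diff_subset)
  then have card: "card (Sym m (B' - I)) = card (Sym m (B - I))"
    using card_Sym[of "B' - I" m] card_Sym[of "B - I" m] B'V BV by (metis Diff_subset subset_trans)
  \<comment> \<open>Return from \<open>B'\<close> to \<open>B\<close>: \<open>?T\<close> spans every
    word with prefix \<open>?u\<close>, because those over \<open>B\<close> that use a letter of
    \<open>I\<close> already lie in \<open>?S\<close>. Its rank is therefore at least that of the
    family over \<open>B' - I\<close>, which has equally many words, so the words over
    \<open>B - I\<close> are independent over \<open>?S\<close> too.\<close>
  let ?T = "?S \<union> (+) ?u ` Sym m (B - I)"
  have T: "?T \<subseteq> ground N" using meeting_subset sub[of "B - I"] BV by auto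
  have "(+) ?u ` Sym m B \<subseteq> ?T"
  proof
    fix w assume w: "w \<in> (+) ?u ` Sym m B"
    then obtain \<beta> where \<beta>: "w = ?u + \<beta>" "\<beta> \<in> Sym m B" by blast
    show "w \<in> ?T"
    proof (cases "set_mset \<beta> \<inter> I = {}")
      case True
      then show ?thesis using \<beta> by (auto simp: multisets_of_size_def)
    next
      case False
      then have "set_mset w \<inter> F \<noteq> {}" using \<beta> I by auto
      moreover have "w \<in> Sym k V" using w sub[OF BV] ground_N by blast
      ultimately show ?thesis by (simp add: meeting_def)
    qed
  qed
  then have "(+) ?u ` Sym m V \<subseteq> cl N ?T"
    using shift_Sym_subset_cl[OF add.prems(3) u add.prems(2)] N.cl_mono[OF _ T] by blast
  then have "rk N (?T \<union> (+) ?u ` Sym m V) = rk N ?T" by (rule N.rk_Un_subset_cl[OF T])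
  moreover have "rk N (?S \<union> (+) ?u ` Sym m (B' - I)) \<le> rk N (?T \<union> (+) ?u ` Sym m V)"
  proof (rule N.rk_mono)
    have "Sym m (B' - I) \<subseteq> Sym m V" using B'V by (intro multisets_of_size_mono) auto
    then show "?S \<union> (+) ?u ` Sym m (B' - I) \<subseteq> ?T \<union> (+) ?u ` Sym m V" by blast
    show "?T \<union> (+) ?u ` Sym m V \<subseteq> ground N" using T sub[of V] by blast
  qed
  moreover have "rk N ?T \<le> rk N ?S + card ((+) ?u ` Sym m (B - I))"
    using BV by (intro N.rk_Un_le_card meeting_subset sub) auto
  moreover have "card ((+) ?u ` Sym m (B - I)) = card (Sym m (B - I))"
    by (rule card_image) auto
  ultimately show ?case using eq card by linarith
qed

lemma flat_of_strong:
  assumes strong: "strong_sp_rank_property k M N"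
  shows "flat_property k M N"
  unfolding flat_property_def
proof (intro allI impI)
  fix F assume F: "flat M F"
  then have FV: "F \<subseteq> V" by (simp add: flat_def)
  obtain I B where I: "I \<subseteq> F" "rk M I = card I" "rk M I = rk M F" and B: "basis B" "I \<subseteq> B"
    using M.basis_of_subset[OF FV] unfolding basis_def by metis
  have "w \<in> meeting F" if w: "w \<in> cl N (meeting F)" for w
  proof (rule ccontr)
    assume "w \<notin> meeting F"
    moreover have "w \<in> Sym k V" using w by (simp add: cl_def ground_N)
    ultimately have "set_mset w \<subseteq> V - F" "size w + 0 = k"
      by (auto simp: meeting_def multisets_of_size_def)
    \<comment> \<open>With the whole word as prefix, \<open>Sym 0 (B - I)\<close> contains only the
      empty word, so the shifted family is just \<open>w\<close>.\<close>
    then have "rk N (insert w (meeting F)) = rk N (meeting F) + 1"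
      using contracted_shift_Sym_independent[OF strong F I _ _ B, of w 0] by simp
    then show False using w by (simp add: cl_def)
  qed
  then have "flat N (meeting F)"
    using N.subset_cl meeting_subset by (auto simp: flat_def)
  then show "flat N (word_prod (Sym 1 F) (Sym (k - 1) V))"
    by (simp only: word_prod_eq_meeting[OF FV])
qed

end

theorem theorem2p4:
  fixes M :: "'a matroid_data" and N :: "'a multiset matroid_data" and k :: nat
  assumes "k \<ge> 2"
    and "matroid M"
    and "matroid N" and "ground N = Sym k (ground M)"
  shows "(strong_sp_rank_property k M N \<and> weak_order_multilinearity k M N \<longleftrightarrow>
            sp_rank_property k M N \<and> closure_property k M N \<and> weak_order_multilinearity k M N) \<and>
         (strong_sp_rank_property k M N \<and> weak_order_multilinearity k M N \<longrightarrow>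
            flat_property k M N)"
proof (cases "weak_order_multilinearity k M N")
  case True
  interpret multilinear_weak_order k M N
    using assms True by unfold_locales auto
  show ?thesis
    using True sp_rank_of_strong closure_of_strong strong_of_sp_rank_closure flat_of_strong by blast
qed simp

end
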